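(* Let $\{x_k\}_{k\ge 0}$ be the infinite sequence generated by the algorithm $\mathrm{SSARC_qK}$ (described in the context) applied to the problem of minimizing $f(x)$ over $x\in\mathbb R^n$ subject to $c(x)=0$. Assume: (A1) $f$ is uniformly bounded from below, and $g=\nabla f$ and $c$ are uniformly bounded; (A2) $g$, $c$ and $\nabla c_i$ ($i=1,\dots,p$) are Lipschitz continuous in some open set $\mathcal C\supseteq\{x_k\}$; (A3) there is a constant $\kappa_{\rm B}\ge 0$ with $\|B_k\|\le\kappa_{\rm B}$ for all $k$; (A4) there is a constant $\kappa_{\rm n}>0$ with $\|v_k^c\|\le\kappa_{\rm n}\|c(x_k)\|$ for all $k$. Then $$\liminf_{k\to\infty}\|Z_k^Tg_k\|=0.$$
   Context: Problem and notation. $f:\mathbb R^n\to\mathbb R$ and $c:\mathbb R^n\to\mathbb R^p$, $p\le n$, are sufficiently smooth; $g=\nabla f$; $J(x)$ is the $p\times n$ Jacobian of $c$; $\|\cdot\|$ is the Euclidean (and induced matrix) norm. Write $g_k=g(x_k)$, $c_k=c(x_k)$, $J_k=J(x_k)$. $B_k$ is the Hessian in $x$ of the Lagrangian $f(x)-s^Tc(x)$ at $(x_k,s_k)$, or a symmetric approximation of it. $J_k$ is assumed to have full row rank for all $k$. The columns of $Z_k$ form an orthonormal basis of the null space of $J_k$. A KKT (first-order critical) point is a point $x$ with $c(x)=0$ and $g(x)\in\operatorname{range}J(x)^T$. Parameters. $0<\eta_1<\eta_2<1$, $0<\gamma_1<1<\gamma_2$, $\nu\in(0,1)$, $\tau_1>1$,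 $\tau_2>0$, $\theta\in(0,1]$, $\xi>0$, $\zeta\in(0,1]$, $t\ge1$, positive integers $e_L,e_U$, and the shifts $\lambda_{(0)}=10^{-e_L/2}$, $\lambda_{(i+1)}=10^{1/2}\lambda_{(i)}$, $i=0,\dots,m$ with $m=e_L+e_U$, satisfying $10^{-e_L}\le\lambda_{(i)}\le10^{e_U}$. Start: $x_0\in\mathbb R^n$, $\beta_0>0$, $\mu_{-1}>0$, $k=0$. Shifted CG-Lanczos, for data $(B,b)$ ($B$ symmetric) and shift $\lambda$: set $w_0=0$, $a_0\upsilon_0=-b$ with $a_0>0$, $\|\upsilon_0\|=1$, $p_0=-b$, $\upsilon_{-1}=0$, $\sigma_0=a_0$, $\omega_{-1}=0$, $\pi_{-1}=1$. For $l=0,1,\dots$, while $\|b+(B+\lambda I)w_l\|>\xi\min\{\|b\|,\|w_l\|\}^{1+\zeta}$: $\delta_l=\upsilon_l^TB\upsilon_l$; $a_{l+1}\upsilon_{l+1}=B\upsilon_l-\delta_l\upsilon_l-a_l\upsilon_{l-1}$ with $a_{l+1}>0$, $\|\upsilon_{l+1}\|=1$; $\delta_l\leftarrow\delta_l+\lambda$; $\pi_l=1/(\delta_l-\omega_{l-1}/\pi_{l-1})$; break (negative curvature) if $\pi_l<0$; $\omega_l=(a_{l+1}\pi_l)^2$; $\sigma_{l+1}=-a_{l+1}\pi_l\sigma_l$; $w_{l+1}=w_l+\pi_lp_l$; $p_{l+1}=\sigma_{l+1}\upsilon_{l+1}+\omega_lp_l$. Output $u(\lambda)$: the final $w_l$.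 Functions. $\phi(x,\mu)=f(x)+\mu\|c(x)\|$ and $q(x,B,\mu,d)=f(x)+g(x)^Td+\frac12d^TBd+\mu\|c(x)+J(x)d\|$. Algorithm $\mathrm{SSARC_qK}$. While $x_k$ is not a KKT point, do the following (outer iteration $k$). (1) Vertical step, computed once per outer iteration: $v_k^c=-J_k^T(J_kJ_k^T)^{-1}c_k$, $v_k=\alpha_kv_k^c$ with $\alpha_k\in\left[\min\{1,\theta\sqrt{\beta_k}/\|v_k^c\|\},\ \min\{1,\sqrt{\beta_k}/\|v_k^c\|\}\right]$ (so $v_k=0$ if $c_k=0$). (2) With $g_k^Z=Z_k^T(g_k+B_kv_k)$ and $B_k^Z=Z_k^TB_kZ_k$, compute, once per outer iteration, $u(\lambda_{(i)})$ for all shifts by shifted CG-Lanczos with data $(B_k^Z,g_k^Z)$ (approximate solution of $(B_k^Z+\lambda_{(i)}I)u=-g_k^Z$), and set $d(\lambda_{(i)})=v_k+Z_ku(\lambda_{(i)})$. (3) Let $i^+=\min\{0\le i\le m: B_k^Z+\lambda_{(i)}I\succ0\}$ (the smallest shift for which no negative curvature is detected) and let $j$ minimize $\left|\beta_k\lambda_{(i)}-\|u(\lambda_{(i)})\|\right|$ over $i^+\le i\le m$. (4) Inner loop, repeated until a trial step is accepted: (4a) Set $\lambda_k=\lambda_{(j)}$, $u_k=u(\lambda_{(j)})$, $h_k=Z_ku_k$ (horizontal step), $d_k=d(\lambda_{(j)})=v_k+h_k$. (4b) Put $\Delta q_k^N=\|c_k\|-\|c_k+J_kv_k\|$, $\Delta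 q_k^H=-(g_k+B_kv_k)^Th_k-\frac12h_k^TB_kh_k$, $\Delta q_k^F=-g_k^Tv_k-\frac12v_k^TB_kv_k$ and $\mu_k^c=-\dfrac{\Delta q_k^F+\Delta q_k^H}{(1-\nu)\Delta q_k^N}$; set $\mu_k=\max\{\mu_k^c,\tau_1\mu_{k-1},\mu_{k-1}+\tau_2\}$ if $\mu_{k-1}<\mu_k^c$, and $\mu_k=\mu_{k-1}$ otherwise (also if $\Delta q_k^N=0$). This enforces $\Delta q_k:=q(x_k,B_k,\mu_k,0)-q(x_k,B_k,\mu_k,d_k)=\Delta q_k^H+\mu_k\Delta q_k^N+\Delta q_k^F\ge\nu\mu_k\Delta q_k^N$. (4c) Compute $\rho_k=\dfrac{\phi(x_k,\mu_k)-\phi(x_k+d_k,\mu_k)}{\Delta q_k}$. (4d) If $\rho_k<\eta_1$ (trial rejected): set $\beta_{k+1}=\beta_k$, and while $\beta_{k+1}>\gamma_1\beta_k$ set $\beta_{k+1}=\|u(\lambda_{(j+1)})\|/\lambda_{(j+1)}$ and $j\leftarrow j+1$ (the sample of shifts is supposed to contain large enough values for this search to succeed); then return to (4a) with the new $j$. Neither $v_k$ nor any $u(\lambda_{(i)})$ is recomputed, and $k$ is not advanced. (4e) If $\rho_k\ge\eta_1$ (trial accepted): set $x_{k+1}=x_k+d_k$, update $B_{k+1}$, set $\beta_{k+1}=\gamma_2\beta_k$ if $\rho_k>\eta_2$ and $\beta_{k+1}=\beta_k$ otherwise, and leave the inner loop. (5) $k\leftarrow k+1$. Standing assumptions. The algorithm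 does not stop at a KKT point, so the sequence is infinite. For all $k$, with residual $r_k:=g_k^Z+(B_k^Z+\lambda_kI)u_k$, the pair $(\lambda_k,u_k)$ used at iteration $k$ satisfies $u_k^T(B_k^Z+\lambda_kI)u_k\ge0$, $\frac1t\frac{\|u_k\|}{\beta_k}\le\lambda_k\le t\frac{\|u_k\|}{\beta_k}$ and $\|r_k\|\le\xi\min\{\|g_k^Z\|,\|u_k\|\}^{1+\zeta}$; and $\beta_k\le\beta_{\max}$ for all $k\ge 0$ and some constant $\beta_{\max}>0$. *)

theory Defs
  imports "HOL-Analysis.Analysis"
begin

section \<open>Problem functions\<close>

definition merit :: "('a \<Rightarrow> real) \<Rightarrow> ('a \<Rightarrow> 'b::real_normed_vector) \<Rightarrow> 'a \<Rightarrow> real \<Rightarrow> real" where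
  "merit f c x \<mu> = f x + \<mu> * norm (c x)"

definition model ::
  "(real^'n \<Rightarrow> real) \<Rightarrow> (real^'n \<Rightarrow> real^'n) \<Rightarrow> (real^'n \<Rightarrow> real^'p) \<Rightarrow> (real^'n \<Rightarrow> real^'n^'p) \<Rightarrow>
   real^'n \<Rightarrow> real^'n^'n \<Rightarrow> real \<Rightarrow> real^'n \<Rightarrow> real" where
  "model f g c J x B \<mu> d =
     f x + g x \<bullet> d + 1/2 * (d \<bullet> (B *v d)) + \<mu> * norm (c x + J x *v d)"

definition kkt_point ::
  "(real^'n \<Rightarrow> real^'n) \<Rightarrow> (real^'n \<Rightarrow> real^'p) \<Rightarrow> (real^'n \<Rightarrow> real^'n^'p) \<Rightarrow> real^'n \<Rightarrow> bool" where
  "kkt_point g c J x \<longleftrightarrow> c x = 0 \<and> g x \<in> range (\<lambda>y. transpose (J x) *v y)"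

definition normal_step :: "real^'n^'p \<Rightarrow> real^'p \<Rightarrow> real^'n" where
  "normal_step A r = - (transpose A *v (matrix_inv (A ** transpose A) *v r))"

definition pos_def :: "real^'m^'m \<Rightarrow> bool" where
  "pos_def A \<longleftrightarrow> (\<forall>u. u \<noteq> 0 \<longrightarrow> 0 < u \<bullet> (A *v u))"

text \<open>
  Since the null space may be trivial, while a matrix type has at least one column, the columns
  of \<open>Z\<close> that count are those indexed by \<open>I\<close>; the others are zero padding. So a vector of
  dimension \<open>card I\<close> is represented by one that vanishes outside \<open>I\<close>. Norms and inner products
  are unaffected, and for \<open>\<lambda> > 0\<close> neither is definiteness of \<open>transpose Z ** B ** Z + mat \<lambda>\<close>.
  For \<open>I = UNIV\<close> there is no padding.
\<close>

definition null_space_basis :: "'m set \<Rightarrow> real^'n^'p \<Rightarrow> real^'m^'n \<Rightarrow> bool" where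
  "null_space_basis I A Z \<longleftrightarrow>
     (\<forall>i\<in>I. \<forall>j\<in>I. column i Z \<bullet> column j Z = (if i = j then 1 else 0)) \<and>
     (\<forall>i. i \<notin> I \<longrightarrow> column i Z = 0) \<and>
     span ((\<lambda>i. column i Z) ` I) = {y. A *v y = 0}"


section \<open>Shifts\<close>

primrec shift :: "nat \<Rightarrow> nat \<Rightarrow> real" where
  "shift eL 0 = 10 powr (- (real eL / 2))"
| "shift eL (Suc i) = 10 powr (1/2) * shift eL i"

lemma shift_eq: "shift eL i = 10 powr ((real i - real eL) / 2)"
  by (induction i) (simp_all flip: powr_add add: field_simps)

lemma shift_bounds:
  assumes "i \<le> eL + eU"
  shows "10 powr (- real eL) \<le> shift eL i" and "shift eL i \<le> 10 powr (real eU)"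
  using assms by (simp_all add: shift_eq)


section \<open>Shifted CG-Lanczos\<close>

text \<open>
  The state at the head of pass \<open>l\<close> holds
  \<open>w\<^sub>l, p\<^sub>l, \<upsilon>\<^sub>l, \<upsilon>\<^sub>l\<^sub>-\<^sub>1, a\<^sub>l, \<sigma>\<^sub>l, \<omega>\<^sub>l\<^sub>-\<^sub>1, \<pi>\<^sub>l\<^sub>-\<^sub>1\<close>.
\<close>

record 'm cg_state =
  cg_w :: "real^'m"
  cg_p :: "real^'m"
  cg_ups :: "real^'m"
  cg_ups_prev :: "real^'m"
  cg_a :: real
  cg_sigma :: real
  cg_omega :: real
  cg_pi :: real

definition cg_init :: "real^'m \<Rightarrow> 'm cg_state" where
  "cg_init b = \<lparr> cg_w = 0, cg_p = - b, cg_ups = (- b) /\<^sub>R norm b, cg_ups_prev = 0,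
     cg_a = norm b, cg_sigma = norm b, cg_omega = 0, cg_pi = 1 \<rparr>"

definition cg_delta :: "real^'m^'m \<Rightarrow> 'm cg_state \<Rightarrow> real" where
  "cg_delta B s = cg_ups s \<bullet> (B *v cg_ups s)"

definition cg_new_pi :: "real^'m^'m \<Rightarrow> real \<Rightarrow> 'm cg_state \<Rightarrow> real" where
  "cg_new_pi B lam s = 1 / ((cg_delta B s + lam) - cg_omega s / cg_pi s)"

text \<open>
  In the case of breakdown (\<open>z = 0\<close> below) no unit vector \<open>\<upsilon>\<^sub>l\<^sub>+\<^sub>1\<close> exists; the value used is
  then \<open>0\<close>. It is immaterial: if \<open>B + \<lambda>I\<close> is positive definite, the new iterate solves the
  system exactly and the loop ends.
\<close>

definition cg_step :: "real^'m^'m \<Rightarrow> real \<Rightarrow> 'm cg_state \<Rightarrow> 'm cg_state" where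
  "cg_step B lam s =
    (let z = B *v cg_ups s - cg_delta B s *\<^sub>R cg_ups s - cg_a s *\<^sub>R cg_ups_prev s;
         a = norm z;
         ups = z /\<^sub>R a;
         \<pi> = cg_new_pi B lam s;
         \<omega> = (a * \<pi>)\<^sup>2;
         \<sigma> = - a * \<pi> * cg_sigma s
     in \<lparr> cg_w = cg_w s + \<pi> *\<^sub>R cg_p s, cg_p = \<sigma> *\<^sub>R ups + \<omega> *\<^sub>R cg_p s, cg_ups = ups,
          cg_ups_prev = cg_ups s, cg_a = a, cg_sigma = \<sigma>, cg_omega = \<omega>, cg_pi = \<pi> \<rparr>)"

definition cg_iter :: "real^'m^'m \<Rightarrow> real^'m \<Rightarrow> real \<Rightarrow> nat \<Rightarrow> 'm cg_state" where
  "cg_iter B b lam l = (cg_step B lam ^^ l) (cg_init b)"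

definition cg_stops ::
  "real \<Rightarrow> real \<Rightarrow> real^'m^'m \<Rightarrow> real^'m \<Rightarrow> real \<Rightarrow> 'm cg_state \<Rightarrow> bool" where
  "cg_stops \<xi> \<zeta> B b lam s \<longleftrightarrow>
     norm (b + (B + mat lam) *v cg_w s) \<le> \<xi> * min (norm b) (norm (cg_w s)) powr (1 + \<zeta>) \<or>
     cg_new_pi B lam s < 0"

definition cg_lanczos ::
  "real \<Rightarrow> real \<Rightarrow> real^'m^'m \<Rightarrow> real^'m \<Rightarrow> real \<Rightarrow> real^'m" where
  "cg_lanczos \<xi> \<zeta> B b lam =
     cg_w (cg_iter B b lam (LEAST l. cg_stops \<xi> \<zeta> B b lam (cg_iter B b lam l)))"


section \<open>The algorithm\<close>

locale ssarcqk_problem =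
  fixes f :: "real^'n \<Rightarrow> real"
    and g :: "real^'n \<Rightarrow> real^'n"
    and c :: "real^'n \<Rightarrow> real^'p"
    and J :: "real^'n \<Rightarrow> real^'n^'p"
  assumes dim: "CARD('p) \<le> CARD('n)"
    and gradient: "\<And>y. GDERIV f y :> g y"
    and jacobian: "\<And>y. (c has_derivative (\<lambda>h. J y *v h)) (at y)"
    and gradient_cont: "continuous_on UNIV g"
    and jacobian_cont: "continuous_on UNIV J"

locale ssarcqk_params =
  fixes \<eta>1 \<eta>2 \<gamma>1 \<gamma>2 \<nu> \<tau>1 \<tau>2 \<theta> \<xi> \<zeta> t :: real
    and eL eU :: nat
  assumes eta: "0 < \<eta>1" "\<eta>1 < \<eta>2" "\<eta>2 < 1"
    and gamma: "0 < \<gamma>1" "\<gamma>1 < 1" "1 < \<gamma>2"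
    and nu: "0 < \<nu>" "\<nu> < 1"
    and tau: "1 < \<tau>1" "0 < \<tau>2"
    and theta: "0 < \<theta>" "\<theta> \<le> 1"
    and xi: "0 < \<xi>"
    and zeta: "0 < \<zeta>" "\<zeta> \<le> 1"
    and t: "1 \<le> t"
    and exponents: "0 < eL" "0 < eU"

text \<open>
  For the outer iteration \<open>k\<close>: \<open>\<beta> k\<close> is the value on entry; \<open>j k\<close> is the shift index of the
  accepted trial, so \<open>\<lambda>\<^sub>k = shift eL (j k)\<close> and \<open>u\<^sub>k = u k (j k)\<close>; \<open>b k\<close> is the value of the
  parameter \<open>\<beta>\<close> in force at the accepted trial; \<open>\<mu> k\<close> is the penalty parameter of the accepted
  trial, and \<open>\<mu>\<^sub>i\<^sub>n\<^sub>i\<^sub>t\<close> is the one preceding \<open>\<mu> 0\<close>.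

  A rejection assigns a reduced value to \<open>\<beta>\<^sub>k\<^sub>+\<^sub>1\<close> without advancing \<open>k\<close>. The flag \<open>carry\<close> tells
  whether that value replaces \<open>\<beta>\<^sub>k\<close> for the rest of the outer iteration (\<open>True\<close>) or only serves
  to find the next shift (\<open>False\<close>, whence \<open>b k = \<beta> k\<close>).
\<close>

locale ssarcqk_data =
  ssarcqk_problem f g c J + ssarcqk_params \<eta>1 \<eta>2 \<gamma>1 \<gamma>2 \<nu> \<tau>1 \<tau>2 \<theta> \<xi> \<zeta> t eL eU
  for f :: "real^'n \<Rightarrow> real"
    and g :: "real^'n \<Rightarrow> real^'n"
    and c :: "real^'n \<Rightarrow> real^'p"
    and J :: "real^'n \<Rightarrow> real^'n^'p"
    and \<eta>1 \<eta>2 \<gamma>1 \<gamma>2 \<nu> \<tau>1 \<tau>2 \<theta> \<xi> \<zeta> t :: real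
    and eL eU :: nat +
  fixes carry :: bool
    and x :: "nat \<Rightarrow> real^'n"
    and B :: "nat \<Rightarrow> real^'n^'n"
    and Z :: "nat \<Rightarrow> real^'m^'n"
    and v :: "nat \<Rightarrow> real^'n"
    and \<beta> :: "nat \<Rightarrow> real"
    and \<mu>\<^sub>i\<^sub>n\<^sub>i\<^sub>t :: real
    and \<mu> :: "nat \<Rightarrow> real"
    and j :: "nat \<Rightarrow> nat"
    and b :: "nat \<Rightarrow> real"
begin

definition gZ :: "nat \<Rightarrow> real^'m" where
  "gZ k = transpose (Z k) *v (g (x k) + B k *v v k)"

definition BZ :: "nat \<Rightarrow> real^'m^'m" where
  "BZ k = transpose (Z k) ** B k ** Z k"

definition u :: "nat \<Rightarrow> nat \<Rightarrow> real^'m" where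
  "u k i = cg_lanczos \<xi> \<zeta> (BZ k) (gZ k) (shift eL i)"

definition h :: "nat \<Rightarrow> nat \<Rightarrow> real^'n" where
  "h k i = Z k *v u k i"

definition d :: "nat \<Rightarrow> nat \<Rightarrow> real^'n" where
  "d k i = v k + h k i"

definition dqN :: "nat \<Rightarrow> real" where
  "dqN k = norm (c (x k)) - norm (c (x k) + J (x k) *v v k)"

definition dqH :: "nat \<Rightarrow> nat \<Rightarrow> real" where
  "dqH k i = - ((g (x k) + B k *v v k) \<bullet> h k i) - 1/2 * (h k i \<bullet> (B k *v h k i))"

definition dqF :: "nat \<Rightarrow> real" where
  "dqF k = - (g (x k) \<bullet> v k) - 1/2 * (v k \<bullet> (B k *v v k))"

definition \<mu>_prev :: "nat \<Rightarrow> real" where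
  "\<mu>_prev k = (case k of 0 \<Rightarrow> \<mu>\<^sub>i\<^sub>n\<^sub>i\<^sub>t | Suc l \<Rightarrow> \<mu> l)"

definition \<mu>_c :: "nat \<Rightarrow> nat \<Rightarrow> real" where
  "\<mu>_c k i = - ((dqF k + dqH k i) / ((1 - \<nu>) * dqN k))"

definition \<mu>_trial :: "nat \<Rightarrow> nat \<Rightarrow> real" where
  "\<mu>_trial k i =
     (if dqN k \<noteq> 0 \<and> \<mu>_prev k < \<mu>_c k i
      then Max {\<mu>_c k i, \<tau>1 * \<mu>_prev k, \<mu>_prev k + \<tau>2}
      else \<mu>_prev k)"

definition dq :: "nat \<Rightarrow> nat \<Rightarrow> real" where
  "dq k i = model f g c J (x k) (B k) (\<mu>_trial k i) 0
          - model f g c J (x k) (B k) (\<mu>_trial k i) (d k i)"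

definition \<rho> :: "nat \<Rightarrow> nat \<Rightarrow> real" where
  "\<rho> k i = (merit f c (x k) (\<mu>_trial k i) - merit f c (x k + d k i) (\<mu>_trial k i)) / dq k i"

definition vertical_step :: "nat \<Rightarrow> bool" where
  "vertical_step k \<longleftrightarrow>
     (let vc = normal_step (J (x k)) (c (x k)) in
      (vc = 0 \<longrightarrow> v k = 0) \<and>
      (vc \<noteq> 0 \<longrightarrow>
        (\<exists>\<alpha>. min 1 (\<theta> * sqrt (\<beta> k) / norm vc) \<le> \<alpha> \<and> \<alpha> \<le> min 1 (sqrt (\<beta> k) / norm vc) \<and>
             v k = \<alpha> *\<^sub>R vc)))"

definition first_index :: "nat \<Rightarrow> nat \<Rightarrow> bool" where
  "first_index k i \<longleftrightarrow>
     (\<exists>ip. is_arg_min (\<lambda>l. l) (\<lambda>l. l \<le> eL + eU \<and> pos_def (BZ k + mat (shift eL l))) ip \<and>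
           is_arg_min (\<lambda>l. \<bar>\<beta> k * shift eL l - norm (u k l)\<bar>) (\<lambda>l. ip \<le> l \<and> l \<le> eL + eU) i)"

definition ratio :: "nat \<Rightarrow> nat \<Rightarrow> real" where
  "ratio k i = norm (u k i) / shift eL i"

text \<open>
  \<open>reject k (i, \<beta>) (i', \<beta>')\<close>: the trial with shift index \<open>i\<close> and parameter value \<open>\<beta>\<close> is
  rejected, the search loop is entered (\<open>\<gamma>1 * \<beta> < \<beta>\<close>) and ends at \<open>i'\<close>, and \<open>\<beta>'\<close> is in force
  at the next trial.
\<close>

definition reject :: "nat \<Rightarrow> nat \<times> real \<Rightarrow> nat \<times> real \<Rightarrow> bool" where
  "reject k = (\<lambda>(i, \<beta>) (i', \<beta>').
     \<rho> k i < \<eta>1 \<and> \<gamma>1 * \<beta> < \<beta> \<and>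
     i < i' \<and> i' \<le> eL + eU \<and> ratio k i' \<le> \<gamma>1 * \<beta> \<and>
     (\<forall>l. i < l \<and> l < i' \<longrightarrow> \<gamma>1 * \<beta> < ratio k l) \<and>
     \<beta>' = (if carry then ratio k i' else \<beta>))"

end

locale ssarcqk_run =
  ssarcqk_data f g c J \<eta>1 \<eta>2 \<gamma>1 \<gamma>2 \<nu> \<tau>1 \<tau>2 \<theta> \<xi> \<zeta> t eL eU carry x B Z v \<beta> \<mu>\<^sub>i\<^sub>n\<^sub>i\<^sub>t \<mu> j b
  for f :: "real^'n \<Rightarrow> real"
    and g :: "real^'n \<Rightarrow> real^'n"
    and c :: "real^'n \<Rightarrow> real^'p"
    and J :: "real^'n \<Rightarrow> real^'n^'p"
    and \<eta>1 \<eta>2 \<gamma>1 \<gamma>2 \<nu> \<tau>1 \<tau>2 \<theta> \<xi> \<zeta> t :: real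
    and eL eU :: nat
    and carry :: bool
    and x :: "nat \<Rightarrow> real^'n"
    and B :: "nat \<Rightarrow> real^'n^'n"
    and Z :: "nat \<Rightarrow> real^'m^'n"
    and v :: "nat \<Rightarrow> real^'n"
    and \<beta> :: "nat \<Rightarrow> real"
    and \<mu>\<^sub>i\<^sub>n\<^sub>i\<^sub>t :: real
    and \<mu> :: "nat \<Rightarrow> real"
    and j :: "nat \<Rightarrow> nat"
    and b :: "nat \<Rightarrow> real" +
  fixes I :: "'m set"
  assumes start: "0 < \<beta> 0" "0 < \<mu>\<^sub>i\<^sub>n\<^sub>i\<^sub>t"
    and not_kkt: "\<And>k. \<not> kkt_point g c J (x k)"
    and full_rank: "\<And>k. rank (J (x k)) = CARD('p)"
    and card_I: "card I = CARD('n) - CARD('p)"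
    and Z_basis: "\<And>k. null_space_basis I (J (x k)) (Z k)"
    and B_sym: "\<And>k. transpose (B k) = B k"
    and vertical: "\<And>k. vertical_step k"
    and inner_loop: "\<And>k. \<exists>i. first_index k i \<and> (reject k)\<^sup>*\<^sup>* (i, \<beta> k) (j k, b k)"
    and accepted: "\<And>k. \<eta>1 \<le> \<rho> k (j k)"
    and x_Suc: "\<And>k. x (Suc k) = x k + d k (j k)"
    and \<mu>_eq: "\<And>k. \<mu> k = \<mu>_trial k (j k)"
    and \<beta>_Suc: "\<And>k. \<beta> (Suc k) = (if \<eta>2 < \<rho> k (j k) then \<gamma>2 * b k else b k)"

locale ssarcqk_standing = ssarcqk_run +
  fixes \<beta>max :: real
  assumes curvature:
      "\<And>k. 0 \<le> u k (j k) \<bullet> ((BZ k + mat (shift eL (j k))) *v u k (j k))"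
    and shift_lower: "\<And>k. 1 / t * (norm (u k (j k)) / b k) \<le> shift eL (j k)"
    and shift_upper: "\<And>k. shift eL (j k) \<le> t * (norm (u k (j k)) / b k)"
    and residual:
      "\<And>k. norm (gZ k + (BZ k + mat (shift eL (j k))) *v u k (j k))
           \<le> \<xi> * min (norm (gZ k)) (norm (u k (j k))) powr (1 + \<zeta>)"
    and \<beta>max: "0 < \<beta>max" "\<And>k. \<beta> k \<le> \<beta>max"

end

theory Submission
  imports Defs
begin

text \<open>
  By orthogonality of the Lanczos vectors, every CG iterate is orthogonal to its residual, so the
  horizontal step decreases the model by at least \<open>\<lambda>\<^sub>k / 2 * \<parallel>u\<^sub>k\<parallel>\<^sup>2\<close>. Dividing the merit function
  by \<open>\<mu>\<^sub>k\<close> gives a monotone bounded sequence, hence \<open>\<Delta>q\<^sub>k / \<mu>\<^sub>k \<longlonglongrightarrow> 0\<close>, the decrease of the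
  linearized constraint tends to \<open>0\<close>, and so does \<open>v\<^sub>k\<close>, which it dominates. If \<open>\<parallel>Z\<^sub>k\<^sup>T g\<^sub>k\<parallel>\<close> stayed
  away from \<open>0\<close>, then so would \<open>\<parallel>u\<^sub>k\<parallel>\<close>, because the shifts range over a finite set; the horizontal
  decrease would then outweigh the effect of \<open>v\<^sub>k\<close> on the objective model, the penalty parameter
  would become constant, and \<open>\<Delta>q\<^sub>k\<close> would be bounded below by a positive constant: a contradiction.
\<close>

section \<open>Matrix identities and orthogonality in the Lanczos recurrence\<close>

lemma inner_transpose_left: "(transpose A *v x) \<bullet> y = x \<bullet> ((A :: real^'n^'m) *v y)"
  by (simp add: dot_lmul_matrix)

lemma symmetric_inner:
  fixes A :: "real^'n^'n"
  assumes "transpose A = A"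
  shows "(A *v x) \<bullet> y = x \<bullet> (A *v y)"
  by (metis assms inner_transpose_left)

lemma mat_mult_vector: "mat lam *v w = lam *\<^sub>R (w :: real^'m)"
  by (vector matrix_vector_mult_def mat_def) (simp add: if_distrib if_distribR cong: if_cong)

text \<open>
  Breakdown is allowed: \<open>q l = 0\<close> from some \<open>l\<close> on, with \<open>a l = 0\<close>.
\<close>

lemma lanczos_orthogonal:
  fixes q q' :: "nat \<Rightarrow> 'a::real_inner"
  assumes sym: "\<And>y z. T y \<bullet> z = y \<bullet> T z"
    and rec: "\<And>l. T (q l) = a (Suc l) *\<^sub>R q (Suc l) + (q l \<bullet> T (q l)) *\<^sub>R q l + a l *\<^sub>R q' l"
    and q'0: "q' 0 = 0" and q'Suc: "\<And>l. q' (Suc l) = q l"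
    and unit: "\<And>l. q l = 0 \<or> norm (q l) = 1"
    and zero: "\<And>l. a l = 0 \<longleftrightarrow> q l = 0"
    and stays: "\<And>l. q l = 0 \<Longrightarrow> q (Suc l) = 0"
    and less: "i < j"
  shows "q i \<bullet> q j = 0"
proof -
  \<comment> \<open>Both indices are bounded by \<open>n\<close>, because moving \<open>T\<close>
    from \<open>q n\<close> to \<open>q i\<close> brings in \<open>q (Suc i)\<close>, which may be
    \<open>q n\<close> itself.\<close>
  have "\<forall>i j. i < j \<and> j \<le> n \<longrightarrow> q i \<bullet> q j = 0" for n
  proof (induction n)
    case (Suc n)
    have orth: "q i \<bullet> q j = 0" if "i \<noteq> j" "i \<le> n" "j \<le> n" for i j
      using Suc that by (metis inner_commute linorder_neqE_nat)
    have orth': "q' i \<bullet> q j = 0" if "i \<le> j" "j \<le> n" for i j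
      using that by (cases i) (auto simp: q'0 q'Suc intro!: orth)
    \<comment> \<open>These absorb the breakdown case: a vector that is not a unit vector is zero,
      and then the coefficients \<open>a\<close> with its index and the next one vanish too.\<close>
    have sq: "a l * (q l \<bullet> q l) = a l" "a (Suc l) * (q l \<bullet> q l) = a (Suc l)" for l
      using unit[of l] zero[of l] zero[of "Suc l"] stays[of l]
      by (auto simp: power2_norm_eq_inner[symmetric])
    have sq': "q l \<bullet> T (q l) * (q l \<bullet> q l) = q l \<bullet> T (q l)" for l
      using unit[of l] by (auto simp: power2_norm_eq_inner[symmetric])
    have new: "q i \<bullet> q (Suc n) = 0" if "i \<le> n" for i
    proof -
      have next_vec: "a (Suc n) *\<^sub>R q (Suc n) = T (q n) - (q n \<bullet> T (q n)) *\<^sub>R q n - a n *\<^sub>R q' n"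
        using rec[of n] by (simp add: algebra_simps)
      have eq: "a (Suc n) * (q (Suc n) \<bullet> q i)
          = T (q n) \<bullet> q i - (q n \<bullet> T (q n)) * (q n \<bullet> q i) - a n * (q' n \<bullet> q i)"
        using arg_cong[OF next_vec, of "\<lambda>y. y \<bullet> q i"] by (simp add: inner_diff_left)
      have "a (Suc n) * (q (Suc n) \<bullet> q i) = 0"
      proof (cases "i = n")
        case True
        then show ?thesis
          using eq orth'[of n n] sq'[of n] by (simp add: inner_commute)
      next
        case False
        with that have "i < n" by simp
        then obtain m where m: "n = Suc m" "i \<le> m" by (cases n) auto
        have "T (q n) \<bullet> q i = q n \<bullet> T (q i)" by (rule sym)
        also have "\<dots> = a (Suc i) * (q n \<bullet> q (Suc i)) + (q i \<bullet> T (q i)) * (q n \<bullet> q i)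
            + a i * (q n \<bullet> q' i)"
          by (subst rec) (simp add: inner_add_right)
        also have "\<dots> = a (Suc i) * (q n \<bullet> q (Suc i))"
          using orth[of n i] orth'[of i n] \<open>i < n\<close> by (simp add: inner_commute)
        finally have T: "T (q n) \<bullet> q i = a (Suc i) * (q n \<bullet> q (Suc i))" .
        \<comment> \<open>For \<open>i = m\<close> both sides equal \<open>a n\<close>; for smaller
          \<open>i\<close> both inner products vanish by induction.\<close>
        have "a (Suc i) * (q n \<bullet> q (Suc i)) = a n * (q m \<bullet> q i)"
        proof (cases "i = m")
          case True
          then show ?thesis using m sq(1)[of n] sq(2)[of m] by auto
        next
          case False
          then show ?thesis using m orth[of n "Suc i"] orth[of m i] by simp
        qed
        then show ?thesis
          using eq T m orth[of n i] \<open>i < n\<close> by (simp add: q'Suc)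
      qed
      then show ?thesis
        using zero[of "Suc n"] by (auto simp: inner_commute)
    qed
    show ?case
      using new Suc by (auto simp: le_Suc_eq)
  qed simp
  from this[of j] less show ?thesis by simp
qed

section \<open>Invariants of the shifted CG-Lanczos iterates\<close>

lemma cg_iter_0: "cg_iter B b lam 0 = cg_init b"
  and cg_iter_Suc: "cg_iter B b lam (Suc l) = cg_step B lam (cg_iter B b lam l)"
  by (simp_all add: cg_iter_def)

text \<open>The Lanczos components of the state evolve independently of the CG components and of the
  shift, so the abstract recurrence applies. Scaling by the inverse of a zero norm yields 0, which
  is how breakdown enters it.\<close>

lemma cg_ups_orthogonal:
  fixes B :: "real^'m^'m"
  assumes sym: "transpose B = B" and "i < j"
  shows "cg_ups (cg_iter B b lam i) \<bullet> cg_ups (cg_iter B b lam j) = 0"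
proof -
  define S where "S = cg_iter B b lam"
  define q where "q l = cg_ups (S l)" for l
  define a where "a l = cg_a (S l)" for l
  define q' where "q' l = cg_ups_prev (S l)" for l
  define z where "z l = B *v q l - (q l \<bullet> (B *v q l)) *\<^sub>R q l - a l *\<^sub>R q' l" for l
  have a_Suc: "a (Suc l) = norm (z l)" and q_Suc: "q (Suc l) = z l /\<^sub>R norm (z l)"
    and q'_Suc: "q' (Suc l) = q l" for l
    by (simp_all add: a_def q_def q'_def z_def S_def cg_iter_Suc cg_step_def cg_delta_def Let_def)
  have init: "a 0 = norm b" "q 0 = (- b) /\<^sub>R norm b" "q' 0 = 0"
    by (simp_all add: a_def q_def q'_def S_def cg_iter_0 cg_init_def)
  have unit: "q l = 0 \<or> norm (q l) = 1" for l
    by (cases l) (simp_all add: init q_Suc divide_inverse[symmetric] mult.commute[of "inverse _"])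
  have zero: "a l = 0 \<longleftrightarrow> q l = 0" for l
    by (cases l) (auto simp: init q_Suc a_Suc)
  have "q i \<bullet> q j = 0"
  proof (rule lanczos_orthogonal[of "(*v) B" q a q'])
    show "B *v q l = a (Suc l) *\<^sub>R q (Suc l) + (q l \<bullet> (B *v q l)) *\<^sub>R q l + a l *\<^sub>R q' l" for l
      by (cases "z l = 0") (auto simp: a_Suc q_Suc, auto simp: z_def algebra_simps)
    show "q (Suc l) = 0" if "q l = 0" for l
      using that zero[of l] by (simp add: q_Suc z_def)
  qed (use symmetric_inner[OF sym] init q'_Suc unit zero \<open>i < j\<close> in auto)
  then show ?thesis by (simp add: q_def S_def)
qed

text \<open>
  The second alternative covers a vanishing pivot: then \<open>cg_pi\<close> is \<open>1 / 0 = 0\<close>, and the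
  iterate stays where it is forever.
\<close>

definition cg_inv :: "real^'m^'m \<Rightarrow> real^'m \<Rightarrow> real \<Rightarrow> 'm cg_state \<Rightarrow> bool" where
  "cg_inv B b lam s \<longleftrightarrow>
     b + (B + mat lam) *v cg_w s = - (cg_sigma s *\<^sub>R cg_ups s) \<and>
     (let z = B *v cg_ups s - cg_delta B s *\<^sub>R cg_ups s - cg_a s *\<^sub>R cg_ups_prev s in
      (B + mat lam) *v cg_p s =
        cg_sigma s *\<^sub>R (((cg_delta B s + lam) - cg_omega s / cg_pi s) *\<^sub>R cg_ups s + z)) \<or>
     cg_sigma s = 0 \<and> cg_p s = 0 \<and> cg_w s \<bullet> (b + (B + mat lam) *v cg_w s) = 0"

lemma cg_inv_init: "cg_inv B b lam (cg_init b)"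
proof -
  define q where "q = (- b) /\<^sub>R norm b"
  \<comment> \<open>For \<open>b = 0\<close> the normalised vector is 0 and the identity
    persists.\<close>
  have b: "- b = norm b *\<^sub>R q" by (cases "b = 0") (auto simp: q_def)
  have "(B + mat lam) *v (- b) = norm b *\<^sub>R (B *v q + lam *\<^sub>R q)"
    by (subst b) (simp only: matrix_vector_mult_scaleR matrix_vector_mult_add_rdistrib mat_mult_vector)
  moreover have "b = - (norm b *\<^sub>R q)"
    using b by (simp flip: b)
  ultimately show ?thesis
    unfolding cg_inv_def cg_init_def cg_delta_def Let_def cg_state.simps q_def[symmetric]
    by (intro disjI1) (simp add: algebra_simps)
qed

text \<open>The image of the direction has component \<open>D\<close> (up to
  \<open>\<sigma>\<close>) along the current Lanczos vector, so the step length \<open>1 / D\<close>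
  cancels the old residual and leaves a multiple of the next Lanczos vector.\<close>

lemma cg_inv_step:
  fixes B :: "real^'m^'m"
  assumes inv: "cg_inv B b lam s" and perp: "cg_w s \<bullet> cg_ups s = 0"
  shows "cg_inv B b lam (cg_step B lam s)"
proof -
  define A where "A = B + mat lam"
  define q where "q = cg_ups s"
  define z where "z = B *v q - cg_delta B s *\<^sub>R q - cg_a s *\<^sub>R cg_ups_prev s"
  define D where "D = (cg_delta B s + lam) - cg_omega s / cg_pi s"
  define a where "a = norm z"
  define q1 where "q1 = z /\<^sub>R a"
  define \<sigma> where "\<sigma> = cg_sigma s"
  define s1 where "s1 = cg_step B lam s"
  have pi: "cg_new_pi B lam s = 1 / D" by (simp add: cg_new_pi_def D_def)
  have s1: "cg_w s1 = cg_w s + (1 / D) *\<^sub>R cg_p s" "cg_ups s1 = q1" "cg_ups_prev s1 = q"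
    "cg_a s1 = a" "cg_sigma s1 = - a * (1 / D) * \<sigma>" "cg_omega s1 = (a * (1 / D))\<^sup>2"
    "cg_pi s1 = 1 / D"
    "cg_p s1 = (- a * (1 / D) * \<sigma>) *\<^sub>R q1 + (a * (1 / D))\<^sup>2 *\<^sub>R cg_p s"
    by (simp_all add: s1_def cg_step_def Let_def pi[unfolded D_def] q1_def a_def z_def q_def \<sigma>_def D_def)
  have z: "z = a *\<^sub>R q1" by (cases "z = 0") (auto simp: q1_def a_def)
  from inv consider
      (reg) "b + A *v cg_w s = - (\<sigma> *\<^sub>R q)" "A *v cg_p s = \<sigma> *\<^sub>R (D *\<^sub>R q + z)"
    | (stat) "\<sigma> = 0" "cg_p s = 0" "cg_w s \<bullet> (b + A *v cg_w s) = 0"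
    by (auto simp: cg_inv_def Let_def A_def \<sigma>_def q_def D_def z_def)
  then show ?thesis
  proof cases
    case stat
    then show ?thesis
      by (fold s1_def) (simp add: cg_inv_def s1 A_def)
  next
    case reg
    show ?thesis
    proof (cases "D = 0")
      case True
      \<comment> \<open>With \<open>1 / D = 0\<close> the iterate is frozen; the orthogonality that
        the second alternative records must be secured now, from \<open>perp\<close>.\<close>
      have "cg_w s \<bullet> (b + A *v cg_w s) = 0"
        using reg(1) perp by (simp add: q_def)
      with True show ?thesis
        by (fold s1_def) (simp add: cg_inv_def s1 A_def)
    next
      case False
      have res: "b + A *v cg_w s1 = - (cg_sigma s1 *\<^sub>R cg_ups s1)"
        using reg False
        by (simp add: s1 matrix_vector_right_distrib matrix_vector_mult_scaleR z
            scaleR_add_right flip: add.assoc)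
      define z1 where "z1 = B *v q1 - cg_delta B s1 *\<^sub>R q1 - a *\<^sub>R q"
      have Aq1: "A *v q1 = z1 + (cg_delta B s1 + lam) *\<^sub>R q1 + a *\<^sub>R q"
        by (simp add: A_def z1_def matrix_vector_mult_add_rdistrib mat_mult_vector algebra_simps)
      have "A *v cg_p s1 = (- a * (1 / D) * \<sigma>) *\<^sub>R (A *v q1) + (a * (1 / D))\<^sup>2 *\<^sub>R (A *v cg_p s)"
        by (simp only: s1 matrix_vector_right_distrib matrix_vector_mult_scaleR)
      also have "\<dots> = (- a * (1 / D) * \<sigma>) *\<^sub>R z1
          + (- a * (1 / D) * \<sigma> * (cg_delta B s1 + lam) + (a * (1 / D))\<^sup>2 * \<sigma> * a) *\<^sub>R q1
          + (- a * (1 / D) * \<sigma> * a + (a * (1 / D))\<^sup>2 * \<sigma> * D) *\<^sub>R q"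
        by (simp only: Aq1 reg(2) z scaleR_add_left scaleR_add_right scaleR_scaleR distrib_left)
          (simp add: algebra_simps)
      \<comment> \<open>This is conjugacy: the choice of \<sigma> and \<omega> removes the component
        along the previous Lanczos vector.\<close>
      also have "- a * (1 / D) * \<sigma> * a + (a * (1 / D))\<^sup>2 * \<sigma> * D = 0"
        using False by (simp add: power2_eq_square)
      also have "- a * (1 / D) * \<sigma> * (cg_delta B s1 + lam) + (a * (1 / D))\<^sup>2 * \<sigma> * a
          = cg_sigma s1 * ((cg_delta B s1 + lam) - cg_omega s1 / cg_pi s1)"
        using False by (simp add: s1 power2_eq_square field_simps)
      finally have "A *v cg_p s1 =
          cg_sigma s1 *\<^sub>R (((cg_delta B s1 + lam) - cg_omega s1 / cg_pi s1) *\<^sub>R q1 + z1)"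
        by (simp add: s1 scaleR_add_right)
      with res show ?thesis
        by (fold s1_def) (simp add: cg_inv_def Let_def A_def z1_def s1(2-4))
    qed
  qed
qed

text \<open>Iterate \<open>l\<close> is a combination of Lanczos vectors of index below
  \<open>l\<close>, and direction \<open>l\<close> of those up to \<open>l\<close>; hence the two
  index ranges. Only the shape of the updates matters, so their coefficients are abstracted
  away.\<close>

lemma cg_iterate_orthogonal:
  fixes B :: "real^'m^'m"
  assumes sym: "transpose B = B"
  shows "(\<forall>i\<ge>l. cg_w (cg_iter B b lam l) \<bullet> cg_ups (cg_iter B b lam i) = 0) \<and>
         (\<forall>i>l. cg_p (cg_iter B b lam l) \<bullet> cg_ups (cg_iter B b lam i) = 0)"
proof (induction l)
  case 0
  have b: "- b = norm b *\<^sub>R cg_ups (cg_iter B b lam 0)"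
    by (cases "b = 0") (auto simp: cg_iter_0 cg_init_def)
  have w: "cg_w (cg_iter B b lam 0) = 0" and p: "cg_p (cg_iter B b lam 0) = - b"
    by (simp_all add: cg_iter_0 cg_init_def)
  have "- b \<bullet> cg_ups (cg_iter B b lam i) = 0" if "0 < i" for i
    by (subst b) (simp add: cg_ups_orthogonal[OF sym that])
  with w p show ?case by simp
next
  case (Suc l)
  have orth: "cg_ups (cg_iter B b lam (Suc l)) \<bullet> cg_ups (cg_iter B b lam i) = 0" if "Suc l < i" for i
    using cg_ups_orthogonal[OF sym that] .
  define s where "s = cg_iter B b lam l"
  have "\<exists>\<pi>. cg_w (cg_step B lam s) = cg_w s + \<pi> *\<^sub>R cg_p s"
    and "\<exists>\<sigma> \<omega>. cg_p (cg_step B lam s) = \<sigma> *\<^sub>R cg_ups (cg_step B lam s) + \<omega> *\<^sub>R cg_p s"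
    unfolding cg_step_def Let_def cg_state.simps by blast+
  then obtain \<pi> \<sigma> \<omega> where
    w: "cg_w (cg_iter B b lam (Suc l)) = cg_w (cg_iter B b lam l) + \<pi> *\<^sub>R cg_p (cg_iter B b lam l)"
    and p: "cg_p (cg_iter B b lam (Suc l))
        = \<sigma> *\<^sub>R cg_ups (cg_iter B b lam (Suc l)) + \<omega> *\<^sub>R cg_p (cg_iter B b lam l)"
    by (auto simp: cg_iter_Suc s_def)
  show ?case
    unfolding w p using Suc orth by (simp add: inner_add_left)
qed

lemma cg_inv_iter:
  fixes B :: "real^'m^'m"
  assumes "transpose B = B"
  shows "cg_inv B b lam (cg_iter B b lam l)"
proof (induction l)
  case (Suc l)
  with cg_iterate_orthogonal[OF assms, of l b lam] show ?case
    by (simp add: cg_iter_Suc cg_inv_step)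
qed (simp add: cg_iter_0 cg_inv_init)

text \<open>The property holds at every iterate, hence at the one that \<open>LEAST\<close> selects:
  the residual is a multiple of the current Lanczos vector, or the second alternative of
  \<open>cg_inv\<close> gives the claim directly.\<close>

lemma cg_lanczos_residual_orthogonal:
  fixes B :: "real^'m^'m"
  assumes "transpose B = B"
    and w_def: "w = cg_lanczos \<xi> \<zeta> B b lam"
  shows "w \<bullet> (b + (B + mat lam) *v w) = 0"
proof -
  obtain l where w: "w = cg_w (cg_iter B b lam l)"
    unfolding w_def cg_lanczos_def by blast
  have "w \<bullet> cg_ups (cg_iter B b lam l) = 0"
    using cg_iterate_orthogonal[OF assms(1), of l b lam] by (simp add: w)
  with cg_inv_iter[OF assms(1), of b lam l] show ?thesis
    by (auto simp: cg_inv_def Let_def w)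
qed

section \<open>The vertical step and bounds for null space bases\<close>

lemma transpose_matrix_component: "(transpose A *v y) $ i = column i A \<bullet> (y :: real^'n)"
  by (simp add: matrix_vector_mult_def transpose_def column_def inner_vec_def)

text \<open>Full row rank makes \<open>transpose A\<close> injective, so
  \<open>A ** transpose A\<close> has trivial kernel and \<open>matrix_inv\<close> is a true
  inverse.\<close>

lemma normal_step_solves:
  fixes A :: "real^'n^'p"
  assumes "rank A = CARD('p)"
  shows "A *v normal_step A r = - r"
proof -
  have inj: "inj ((*v) (transpose A))"
    using assms by (simp add: rank_transpose flip: full_rank_injective)
  have "y = 0" if "(A ** transpose A) *v y = 0" for y
  proof -
    have "(transpose A *v y) \<bullet> (transpose A *v y) = y \<bullet> (A *v (transpose A *v y))"
      by (rule inner_transpose_left)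
    also have "\<dots> = 0"
      using that by (simp only: matrix_vector_mul_assoc) simp
    finally have "transpose A *v y = transpose A *v 0" by simp
    with inj show ?thesis by (rule injD)
  qed
  then obtain M where "M ** (A ** transpose A) = mat 1"
    using matrix_left_invertible_ker by blast
  then have "invertible (A ** transpose A)"
    unfolding invertible_def by (metis matrix_left_right_inverse)
  then have "(A ** transpose A) ** matrix_inv (A ** transpose A) = mat 1"
    unfolding invertible_def matrix_inv_def by (metis (mono_tags, lifting) someI_ex)
  then have "A *v (transpose A *v (matrix_inv (A ** transpose A) *v r)) = r"
    by (simp only: matrix_vector_mul_assoc matrix_mul_assoc matrix_vector_mul_lid)
  then show ?thesis
    unfolding normal_step_def by (simp only: linear_neg[OF matrix_vector_mul_linear])
qed

lemma null_space_basis_column: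
  assumes "null_space_basis I A Z"
  shows "A *v column i Z = 0" and "norm (column i Z) \<le> 1"
proof -
  have "column i Z = 0 \<or> i \<in> I"
    using assms by (auto simp: null_space_basis_def)
  moreover have "column i Z \<in> span ((\<lambda>i. column i Z) ` I)" if "i \<in> I"
    using that by (intro span_base) auto
  ultimately show "A *v column i Z = 0"
    using assms by (auto simp: null_space_basis_def)
  show "norm (column i Z) \<le> 1"
    using assms \<open>column i Z = 0 \<or> i \<in> I\<close>
    by (auto simp: null_space_basis_def norm_eq_sqrt_inner)
qed

lemma null_space_basis_mult:
  assumes "null_space_basis I A Z"
  shows "A *v (Z *v w) = 0"
  by (simp add: matrix_mult_sum[of Z] linear_sum[OF matrix_vector_mul_linear]
      scalar_mult_eq_scaleR matrix_vector_mult_scaleR null_space_basis_column(1)[OF assms])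

text \<open>Summing over columns of norm at most 1 is cruder than using orthonormality, but all that
  matters is a factor independent of \<open>k\<close>.\<close>

lemma null_space_basis_norm:
  fixes Z :: "real^'m^'n"
  assumes "null_space_basis I A Z"
  shows "norm (Z *v w) \<le> card I * norm w"
proof -
  have "Z *v w = (\<Sum>i\<in>I. (w $ i) *s column i Z)"
    unfolding matrix_mult_sum
    using assms by (intro sum.mono_neutral_right) (auto simp: null_space_basis_def)
  also have "norm \<dots> \<le> (\<Sum>i\<in>I. norm ((w $ i) *s column i Z))"
    by (rule norm_sum)
  also have "\<dots> \<le> (\<Sum>i\<in>I. norm w * 1)"
    unfolding scalar_mult_eq_scaleR norm_scaleR
    by (intro sum_mono mult_mono null_space_basis_column(2)[OF assms])
      (auto simp: component_le_norm_cart)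
  finally show ?thesis by simp
qed

lemma null_space_basis_transpose_norm:
  fixes Z :: "real^'m^'n"
  assumes "null_space_basis I A Z"
  shows "norm (transpose Z *v y) \<le> card I * norm y"
proof -
  have "norm (transpose Z *v y) \<le> (\<Sum>i\<in>UNIV. \<bar>(transpose Z *v y) $ i\<bar>)"
    by (rule norm_le_l1_cart)
  also have "\<dots> = (\<Sum>i\<in>I. \<bar>column i Z \<bullet> y\<bar>)"
    unfolding transpose_matrix_component
    using assms by (intro sum.mono_neutral_right) (auto simp: null_space_basis_def)
  also have "\<dots> \<le> (\<Sum>i\<in>I. 1 * norm y)"
    by (intro sum_mono order_trans[OF Cauchy_Schwarz_ineq2] mult_right_mono
        null_space_basis_column(2)[OF assms]) simp
  finally show ?thesis by simp
qed

section \<open>Shifts and the limit inferior\<close>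

lemma shift_pos: "0 < shift eL i"
  by (simp add: shift_eq)

lemma shift_mono: "i \<le> i' \<Longrightarrow> shift eL i \<le> shift eL i'"
  by (simp add: shift_eq)

text \<open>A positive limit inferior lies above some real \<epsilon> > 0, which the sequence then
  eventually exceeds.\<close>

lemma liminf_eq_0I:
  fixes s :: "nat \<Rightarrow> real"
  assumes nonneg: "\<And>k. 0 \<le> s k"
    and not_bounded: "\<And>\<epsilon>. 0 < \<epsilon> \<Longrightarrow> \<not> (\<forall>\<^sub>F k in sequentially. \<epsilon> < s k)"
  shows "liminf (\<lambda>k. ereal (s k)) = 0"
proof (rule antisym)
  show "0 \<le> liminf (\<lambda>k. ereal (s k))"
    by (rule Liminf_bounded) (simp add: nonneg)
  show "liminf (\<lambda>k. ereal (s k)) \<le> 0"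
  proof (rule ccontr)
    assume "\<not> liminf (\<lambda>k. ereal (s k)) \<le> 0"
    then obtain \<epsilon> where "0 < ereal \<epsilon>" "ereal \<epsilon> < liminf (\<lambda>k. ereal (s k))"
      by (metis ereal_dense2 not_le)
    with not_bounded[of \<epsilon>] show False
      by (auto dest: less_LiminfD)
  qed
qed

section \<open>Signs and bounds along a run\<close>

context ssarcqk_standing
begin

text \<open>A positive shift below \<open>t\<close> times the quotient forces the quotient to be
  positive; a zero denominator would make it 0.\<close>

lemma b_pos: "0 < b k" and u_nonzero: "u k (j k) \<noteq> 0"
proof -
  have "0 < t * (norm (u k (j k)) / b k)"
    using shift_pos shift_upper by (rule less_le_trans)
  moreover have "0 < t" using t by simp
  ultimately have "0 < norm (u k (j k)) / b k" by (rule zero_less_mult_pos)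
  then show "0 < b k" "u k (j k) \<noteq> 0" by (auto simp: zero_less_divide_iff)
qed

lemma \<beta>_pos: "0 < \<beta> k"
  using start(1) b_pos gamma by (cases k) (auto simp: \<beta>_Suc)

text \<open>Keeps all accepted shifts in a finite set, so that bounds involving them are uniform in
  \<open>k\<close>.\<close>

lemma j_le: "j k \<le> eL + eU"
proof -
  obtain i where i: "first_index k i" and run: "(reject k)\<^sup>*\<^sup>* (i, \<beta> k) (j k, b k)"
    using inner_loop by blast
  have "i \<le> eL + eU"
    using i by (auto simp: first_index_def is_arg_min_def)
  with run show ?thesis
    by (cases rule: rtranclp.cases) (auto simp: reject_def)
qed

lemma \<mu>_trial_ge: "\<mu>_prev k \<le> \<mu>_trial k i"
  using tau by (simp add: \<mu>_trial_def le_max_iff_disj)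

lemma \<mu>_prev_Suc: "\<mu>_prev (Suc k) = \<mu> k"
  by (simp only: \<mu>_prev_def nat.case)

lemma \<mu>_prev_pos: "0 < \<mu>_prev k"
proof (induction k)
  case (Suc k)
  have "0 < \<mu>_trial k (j k)"
    using Suc \<mu>_trial_ge by (rule less_le_trans)
  then have "0 < \<mu> k" by (subst \<mu>_eq)
  then show ?case by (simp only: \<mu>_prev_Suc)
qed (simp add: \<mu>_prev_def start)

lemma \<mu>_pos: "0 < \<mu> k"
  using \<mu>_prev_pos[of "Suc k"] by (simp add: \<mu>_prev_Suc)

lemma \<mu>_prev_le: "\<mu>_prev k \<le> \<mu> k"
  by (simp add: \<mu>_eq \<mu>_trial_ge)

lemma v_eq:
  obtains \<alpha> where "0 < \<alpha>" "\<alpha> \<le> 1" "v k = \<alpha> *\<^sub>R normal_step (J (x k)) (c (x k))"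
proof (cases "normal_step (J (x k)) (c (x k)) = 0")
  case True
  with vertical[of k] that[of 1] show ?thesis by (simp add: vertical_step_def)
next
  case False
  with vertical[of k] obtain \<alpha> where
    "min 1 (\<theta> * sqrt (\<beta> k) / norm (normal_step (J (x k)) (c (x k)))) \<le> \<alpha>"
    "\<alpha> \<le> min 1 (sqrt (\<beta> k) / norm (normal_step (J (x k)) (c (x k))))"
    "v k = \<alpha> *\<^sub>R normal_step (J (x k)) (c (x k))"
    by (auto simp: vertical_step_def Let_def)
  moreover have "0 < min 1 (\<theta> * sqrt (\<beta> k) / norm (normal_step (J (x k)) (c (x k))))"
    using False theta \<beta>_pos[of k] by simp
  ultimately show ?thesis using that[of \<alpha>] by simp
qed

text \<open>The full normal step solves the linearized constraint, so its multiple by \<alpha> gives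
  \<open>dqN k\<close> = \<alpha> \<open>norm (c (x k))\<close>; the same \<alpha> scales
  \<open>v k\<close>.\<close>

lemma dqN_bounds:
  shows "0 \<le> dqN k"
    and "norm (normal_step (J (x k)) (c (x k))) \<le> \<kappa> * norm (c (x k)) \<Longrightarrow> norm (v k) \<le> \<kappa> * dqN k"
    and "dqN k = 0 \<Longrightarrow> v k = 0"
proof -
  obtain \<alpha> where \<alpha>: "0 < \<alpha>" "\<alpha> \<le> 1" and v: "v k = \<alpha> *\<^sub>R normal_step (J (x k)) (c (x k))"
    by (rule v_eq)
  have "c (x k) + J (x k) *v v k = (1 - \<alpha>) *\<^sub>R c (x k)"
    by (simp add: v matrix_vector_mult_scaleR normal_step_solves full_rank algebra_simps)
  then have dqN: "dqN k = \<alpha> * norm (c (x k))"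
    using \<alpha> unfolding dqN_def by (simp add: left_diff_distrib)
  then show "0 \<le> dqN k" using \<alpha> by simp
  show "norm (v k) \<le> \<kappa> * dqN k"
    if "norm (normal_step (J (x k)) (c (x k))) \<le> \<kappa> * norm (c (x k))"
    using mult_left_mono[OF that, of \<alpha>] \<alpha> by (simp add: v dqN mult.left_commute)
  show "v k = 0" if "dqN k = 0"
  proof -
    have "c (x k) = 0" using that \<alpha> dqN by simp
    then show ?thesis by (simp add: v normal_step_def)
  qed
qed

section \<open>Decrease of the quadratic model\<close>

lemma J_h: "J (x k) *v h k i = 0"
  unfolding h_def by (rule null_space_basis_mult[OF Z_basis])

text \<open>The horizontal step leaves the linearized constraint unchanged, and symmetry of
  \<open>B k\<close> lets \<open>dqH\<close> collect the whole cross term.\<close>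

lemma dq_eq: "dq k i = dqH k i + \<mu>_trial k i * dqN k + dqF k"
proof -
  have "h k i \<bullet> (B k *v v k) = v k \<bullet> (B k *v h k i)"
    using symmetric_inner[OF B_sym, of k "h k i" "v k"] by (simp add: inner_commute)
  then show ?thesis
    by (simp add: dq_def model_def d_def dqH_def dqN_def dqF_def J_h matrix_vector_right_distrib
        inner_add_left inner_add_right algebra_simps)
      (simp add: inner_commute)
qed

text \<open>Orthogonality of \<open>u\<close> to its residual turns \<open>dqH\<close> into half the
  curvature of the shifted matrix along \<open>u\<close> plus half the shift times the squared norm;
  the curvature is nonnegative by assumption.\<close>

lemma dqH_ge: "shift eL (j k) / 2 * (norm (u k (j k)))\<^sup>2 \<le> dqH k (j k)"
proof -
  let ?u = "u k (j k)" and ?A = "BZ k + mat (shift eL (j k))"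
  have "transpose (BZ k) = BZ k"
    by (simp add: BZ_def matrix_transpose_mul B_sym matrix_mul_assoc)
  from cg_lanczos_residual_orthogonal[OF this refl]
  have "?u \<bullet> (gZ k + ?A *v ?u) = 0" by (simp add: u_def)
  then have gu: "gZ k \<bullet> ?u = - (?u \<bullet> (?A *v ?u))"
    by (simp add: inner_add_right inner_commute)
  have "?u \<bullet> (?A *v ?u) = ?u \<bullet> (BZ k *v ?u) + shift eL (j k) * (norm ?u)\<^sup>2"
    by (simp add: matrix_vector_mult_add_rdistrib mat_mult_vector inner_add_right power2_norm_eq_inner)
  moreover have "h k (j k) \<bullet> (B k *v h k (j k)) = ?u \<bullet> (BZ k *v ?u)"
    unfolding h_def BZ_def
    by (metis inner_commute inner_transpose_left matrix_vector_mul_assoc)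
  moreover have "(g (x k) + B k *v v k) \<bullet> h k (j k) = gZ k \<bullet> ?u"
    unfolding h_def gZ_def by (rule inner_transpose_left[symmetric])
  ultimately show ?thesis
    using curvature[of k] gu by (simp add: dqH_def field_simps)
qed

lemma dqH_pos: "0 < dqH k (j k)"
proof -
  have "0 < shift eL (j k) / 2 * (norm (u k (j k)))\<^sup>2"
    using shift_pos u_nonzero by simp
  with dqH_ge show ?thesis by (rule less_le_trans[rotated])
qed

lemma dqF_0: "dqN k = 0 \<Longrightarrow> dqF k = 0"
  using dqN_bounds(3) by (simp add: dqF_def)

text \<open>If \<open>dqN k = 0\<close>, the vertical step vanishes and \<open>dqH\<close> alone
  remains. Otherwise the penalty update gives \<open>\<mu>_c k (j k) \<le> \<mu> k\<close>, which
  rearranges to the second bound.\<close>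

lemma dq_pos: "0 < dq k (j k)" and dq_ge: "\<nu> * \<mu> k * dqN k \<le> dq k (j k)"
proof -
  have "\<nu> * \<mu> k * dqN k \<le> dq k (j k) \<and> dq k (j k) \<noteq> 0"
  proof (cases "dqN k = 0")
    case True
    then show ?thesis using dqH_pos[of k] by (simp add: dq_eq dqF_0)
  next
    case False
    then have N: "0 < dqN k" using dqN_bounds(1)[of k] by simp
    have "\<mu>_c k (j k) \<le> \<mu> k" using False by (auto simp: \<mu>_eq \<mu>_trial_def)
    then have "- (dqF k + dqH k (j k)) \<le> \<mu> k * ((1 - \<nu>) * dqN k)"
      using N nu by (simp add: \<mu>_c_def field_simps)
    then have "\<nu> * \<mu> k * dqN k \<le> dq k (j k)"
      by (simp add: dq_eq \<mu>_eq algebra_simps)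
    moreover have "0 < \<nu> * \<mu> k * dqN k" using N nu \<mu>_pos by simp
    ultimately show ?thesis by simp
  qed
  moreover have "0 \<le> \<nu> * \<mu> k * dqN k"
    using nu less_imp_le[OF \<mu>_pos[of k]] dqN_bounds(1)[of k] by simp
  ultimately show "0 < dq k (j k)" "\<nu> * \<mu> k * dqN k \<le> dq k (j k)" by auto
qed

section \<open>The merit function and vanishing decreases\<close>

lemma merit_decrease:
  "f (x (Suc k)) + \<mu> k * norm (c (x (Suc k))) \<le> f (x k) + \<mu> k * norm (c (x k)) - \<eta>1 * dq k (j k)"
  using accepted[of k] dq_pos[of k] by (simp add: \<rho>_def merit_def x_Suc \<mu>_eq field_simps)

text \<open>
  The merit function divided by the penalty parameter is monotone even across updates of the
  latter, provided \<open>f\<close> is first shifted to be nonnegative.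
\<close>

lemma dq_div_\<mu>_tendsto_0:
  assumes "bdd_below (range f)"
  shows "(\<lambda>k. dq k (j k) / \<mu> k) \<longlonglongrightarrow> 0"
proof -
  obtain m where m: "m \<le> f y" for y
    using assms by (auto simp: bdd_below_def)
  \<comment> \<open>Dividing by \<open>\<mu>_prev k\<close> makes \<open>\<Phi> (Suc k)\<close>
    carry \<open>\<mu> k\<close>, the parameter of the merit decrease at \<open>k\<close>.\<close>
  define \<Phi> where "\<Phi> k = (f (x k) - m) / \<mu>_prev k + norm (c (x k))" for k
  have step: "\<eta>1 * (dq k (j k) / \<mu> k) \<le> \<Phi> k - \<Phi> (Suc k)" for k
  proof -
    have "(f (x k) - m) / \<mu> k \<le> (f (x k) - m) / \<mu>_prev k"
      using m[of "x k"] \<mu>_prev_le[of k] \<mu>_prev_pos[of k] by (intro divide_left_mono) auto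
    moreover have "(f (x (Suc k)) - m) / \<mu> k + norm (c (x (Suc k)))
        \<le> (f (x k) - m) / \<mu> k + norm (c (x k)) - \<eta>1 * (dq k (j k) / \<mu> k)"
      using divide_right_mono[OF merit_decrease[of k] less_imp_le[OF \<mu>_pos[of k]]] \<mu>_pos[of k]
      by (simp add: add_divide_distrib diff_divide_distrib)
    ultimately show ?thesis by (simp add: \<Phi>_def \<mu>_prev_Suc)
  qed
  have pos: "0 < \<eta>1 * (dq k (j k) / \<mu> k)" for k
    using eta dq_pos \<mu>_pos by simp
  have "decseq \<Phi>"
    using step pos by (intro decseq_SucI) (meson diff_gt_0_iff_gt less_imp_le less_le_trans)
  moreover have "0 \<le> \<Phi> k" for k
    using m[of "x k"] \<mu>_prev_pos[of k] by (simp add: \<Phi>_def)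
  ultimately obtain l where "\<Phi> \<longlonglongrightarrow> l"
    using decseq_convergent by blast
  then have "(\<lambda>k. \<Phi> k - \<Phi> (Suc k)) \<longlonglongrightarrow> l - l"
    by (intro tendsto_diff LIMSEQ_Suc)
  then have "(\<lambda>k. \<Phi> k - \<Phi> (Suc k)) \<longlonglongrightarrow> 0" by simp
  then have "(\<lambda>k. \<eta>1 * (dq k (j k) / \<mu> k)) \<longlonglongrightarrow> 0"
    by (rule tendsto_sandwich[OF _ _ tendsto_const, rotated 2])
      (use step pos less_imp_le in \<open>auto intro!: always_eventually\<close>)
  then show ?thesis
    using eta tendsto_mult_left_iff[of \<eta>1 "\<lambda>k. dq k (j k) / \<mu> k" 0] by simp
qed

lemma dqN_tendsto_0:
  assumes "bdd_below (range f)"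
  shows "dqN \<longlonglongrightarrow> 0"
proof -
  have "\<nu> * dqN k \<le> dq k (j k) / \<mu> k" for k
    using dq_ge[of k] \<mu>_pos[of k] by (simp add: field_simps)
  then have "(\<lambda>k. \<nu> * dqN k) \<longlonglongrightarrow> 0"
    using nu dqN_bounds(1)
    by (intro tendsto_sandwich[OF _ _ tendsto_const dq_div_\<mu>_tendsto_0[OF assms]])
      (auto intro!: always_eventually)
  then show ?thesis
    using nu tendsto_mult_left_iff[of \<nu> dqN 0] by simp
qed

section \<open>Bounds using the norm of \<open>B k\<close>, and the contradiction\<close>

lemma norm_B_le:
  assumes "onorm ((*v) (B k)) \<le> \<kappa>B"
  shows "norm (B k *v y) \<le> \<kappa>B * norm y"
  by (rule order_trans[OF onorm[OF matrix_vector_mul_bounded_linear] mult_right_mono[OF assms]]) simp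

lemma dqF_tendsto_0:
  assumes v: "v \<longlonglongrightarrow> 0" and g: "bounded (range g)"
    and B: "\<And>k. onorm ((*v) (B k)) \<le> \<kappa>B"
  shows "dqF \<longlonglongrightarrow> 0"
proof -
  obtain G where G: "norm (g y) \<le> G" for y
    using g by (auto simp: bounded_iff)
  have "norm (dqF k) \<le> G * norm (v k) + 1/2 * (norm (v k) * (\<kappa>B * norm (v k)))" for k
  proof -
    have "\<bar>g (x k) \<bullet> v k\<bar> \<le> G * norm (v k)"
      using Cauchy_Schwarz_ineq2[of "g (x k)" "v k"] mult_right_mono[OF G[of "x k"], of "norm (v k)"]
      by simp
    moreover have "\<bar>v k \<bullet> (B k *v v k)\<bar> \<le> norm (v k) * (\<kappa>B * norm (v k))"
      using Cauchy_Schwarz_ineq2[of "v k" "B k *v v k"]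
        mult_left_mono[OF norm_B_le[OF B, of k "v k"], of "norm (v k)"] by simp
    ultimately show ?thesis unfolding dqF_def real_norm_def by linarith
  qed
  moreover have "(\<lambda>k. G * norm (v k) + 1/2 * (norm (v k) * (\<kappa>B * norm (v k))))
      \<longlonglongrightarrow> G * 0 + 1/2 * (0 * (\<kappa>B * 0))"
    by (intro tendsto_intros tendsto_norm_zero v)
  ultimately show ?thesis
    by (intro Lim_null_comparison[OF always_eventually, of dqF]) auto
qed

text \<open>The norm of \<open>gZ k\<close> is at most that of the residual plus that of the shifted
  matrix times \<open>u\<close>. When \<open>u\<close> has norm at most 1, the power
  \<open>1 + \<zeta>\<close> makes the residual at most \<xi> times that norm, so everything is
  linear in it; \<open>min 1\<close> covers the other case.\<close>

lemma norm_u_ge: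
  assumes B: "onorm ((*v) (B k)) \<le> \<kappa>B" "0 \<le> \<kappa>B"
    and gZ: "\<epsilon> \<le> norm (gZ k)"
  shows "min 1 (\<epsilon> / (\<xi> + ((real (card I))^2 * \<kappa>B + shift eL (eL + eU)))) \<le> norm (u k (j k))"
proof (cases "norm (u k (j k)) \<le> 1")
  case True
  let ?u = "u k (j k)" and ?M = "real (card I)"
  have "norm (BZ k *v ?u) \<le> ?M * norm (B k *v (Z k *v ?u))"
    using null_space_basis_transpose_norm[OF Z_basis, of k "B k *v (Z k *v ?u)"]
    by (simp only: BZ_def matrix_vector_mul_assoc matrix_mul_assoc)
  also have "\<dots> \<le> ?M * (\<kappa>B * (?M * norm ?u))"
    by (intro mult_left_mono order_trans[OF norm_B_le[OF B(1)]] null_space_basis_norm[OF Z_basis]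
        B(2)) simp_all
  finally have BZ: "norm (BZ k *v ?u) \<le> ?M^2 * \<kappa>B * norm ?u"
    by (simp add: power2_eq_square algebra_simps)
  have "norm (shift eL (j k) *\<^sub>R ?u) \<le> shift eL (eL + eU) * norm ?u"
    using shift_mono[OF j_le[of k], of eL] shift_pos[of eL "j k"] by (simp add: mult_right_mono)
  with BZ have A: "norm ((BZ k + mat (shift eL (j k))) *v ?u)
      \<le> (?M^2 * \<kappa>B + shift eL (eL + eU)) * norm ?u"
    using norm_triangle_ineq[of "BZ k *v ?u" "shift eL (j k) *\<^sub>R ?u"]
    by (simp add: matrix_vector_mult_add_rdistrib mat_mult_vector algebra_simps)
  have "min (norm (gZ k)) (norm ?u) powr (1 + \<zeta>) \<le> norm ?u powr (1 + \<zeta>)"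
    using zeta by (intro powr_mono2) auto
  also have "\<dots> \<le> norm ?u powr 1"
    using True zeta by (intro powr_mono') auto
  finally have "norm (gZ k + (BZ k + mat (shift eL (j k))) *v ?u) \<le> \<xi> * norm ?u"
    using residual[of k] xi by (smt (verit) mult_left_mono norm_ge_zero powr_one)
  with A have "norm (gZ k) \<le> (\<xi> + (?M^2 * \<kappa>B + shift eL (eL + eU))) * norm ?u"
    using norm_triangle_ineq4[of "gZ k + (BZ k + mat (shift eL (j k))) *v ?u"
        "(BZ k + mat (shift eL (j k))) *v ?u"]
    by (simp add: distrib_right)
  with gZ have "\<epsilon> \<le> norm ?u * (\<xi> + (?M^2 * \<kappa>B + shift eL (eL + eU)))"
    by (simp add: mult.commute)
  moreover have "0 < \<xi> + (?M^2 * \<kappa>B + shift eL (eL + eU))"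
    using xi B(2) shift_pos[of eL "eL + eU"] by (simp add: add_pos_nonneg add_nonneg_pos)
  ultimately have "\<epsilon> / (\<xi> + (?M^2 * \<kappa>B + shift eL (eL + eU))) \<le> norm ?u"
    by (simp add: pos_divide_le_eq)
  then show ?thesis by simp
qed simp

lemma gradient_not_bounded_away:
  assumes f: "bdd_below (range f)" and g: "bounded (range g)"
    and B: "\<And>k. onorm ((*v) (B k)) \<le> \<kappa>B" "0 \<le> \<kappa>B"
    and v: "\<And>k. norm (normal_step (J (x k)) (c (x k))) \<le> \<kappa>n * norm (c (x k))"
    and \<epsilon>: "0 < \<epsilon>"
  shows "\<not> (\<forall>\<^sub>F k in sequentially. \<epsilon> < norm (transpose (Z k) *v g (x k)))"
proof
  assume large: "\<forall>\<^sub>F k in sequentially. \<epsilon> < norm (transpose (Z k) *v g (x k))"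
  let ?M = "real (card I)"
  \<comment> \<open>Half of \<epsilon> is reserved for the difference between \<open>gZ k\<close>
    and the projected gradient, which tends to 0 with \<open>v k\<close>.\<close>
  define \<delta> where "\<delta> = min 1 (\<epsilon> / 2 / (\<xi> + (?M^2 * \<kappa>B + shift eL (eL + eU))))"
  \<comment> \<open>The smallest shift and \<delta> bound \<open>dqH\<close> from below; half of
    \<kappa> will be spent on a possibly negative \<open>dqF\<close>.\<close>
  define \<kappa> where "\<kappa> = shift eL 0 / 2 * \<delta>\<^sup>2"
  have "0 < \<xi> + (?M^2 * \<kappa>B + shift eL (eL + eU))"
    using xi B(2) shift_pos[of eL "eL + eU"] by (simp add: add_pos_nonneg add_nonneg_pos)
  then have \<delta>: "0 < \<delta>" using \<epsilon> by (simp add: \<delta>_def)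
  then have \<kappa>: "0 < \<kappa>" unfolding \<kappa>_def using shift_pos[of eL 0] by simp
  have "(\<lambda>k. \<kappa>n * dqN k) \<longlonglongrightarrow> 0"
    using tendsto_mult[OF tendsto_const dqN_tendsto_0[OF f]] by simp
  then have v0: "v \<longlonglongrightarrow> 0"
    by (rule Lim_null_comparison[rotated]) (simp add: dqN_bounds(2) v)
  then have "(\<lambda>k. ?M * (\<kappa>B * norm (v k))) \<longlonglongrightarrow> ?M * (\<kappa>B * 0)"
    by (intro tendsto_intros tendsto_norm_zero)
  then have "\<forall>\<^sub>F k in sequentially. ?M * (\<kappa>B * norm (v k)) < \<epsilon> / 2"
    using \<epsilon> by (intro order_tendstoD(2)) auto
  moreover have "\<forall>\<^sub>F k in sequentially. - \<kappa> / 2 < dqF k"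
    using \<kappa> by (intro order_tendstoD(1)[OF dqF_tendsto_0[OF v0 g B(1)]]) auto
  ultimately have ev: "\<forall>\<^sub>F k in sequentially. \<kappa> / 2 \<le> dqF k + dqH k (j k)"
    using large
  proof eventually_elim
    case (elim k)
    have "norm (transpose (Z k) *v (B k *v v k)) \<le> ?M * (\<kappa>B * norm (v k))"
      by (rule order_trans[OF null_space_basis_transpose_norm[OF Z_basis]])
        (intro mult_left_mono norm_B_le B(1), simp)
    moreover have "transpose (Z k) *v g (x k) = gZ k - transpose (Z k) *v (B k *v v k)"
      unfolding gZ_def by (simp only: matrix_vector_right_distrib add_diff_cancel)
    then have "norm (transpose (Z k) *v g (x k))
        \<le> norm (gZ k) + norm (transpose (Z k) *v (B k *v v k))"
      by (simp only: norm_triangle_ineq4)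
    ultimately have "\<epsilon> / 2 \<le> norm (gZ k)"
      using elim by linarith
    from norm_u_ge[OF B(1) B(2) this] have "\<delta> \<le> norm (u k (j k))" by (simp add: \<delta>_def)
    then have "\<kappa> \<le> shift eL (j k) / 2 * (norm (u k (j k)))\<^sup>2"
      unfolding \<kappa>_def using \<delta> shift_mono[of 0 "j k" eL] less_imp_le[OF shift_pos[of eL "j k"]]
      by (intro mult_mono divide_right_mono power_mono) (simp_all del: shift.simps)
    then show ?case using dqH_ge[of k] elim by linarith
  qed
  then obtain K where K: "\<kappa> / 2 \<le> dqF k + dqH k (j k)" if "K \<le> k" for k
    by (auto simp: eventually_sequentially)
  \<comment> \<open>A nonnegative sum \<open>dqF + dqH\<close> makes \<open>\<mu>_c\<close>
    nonpositive, so no update is triggered.\<close>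
  have \<mu>_same: "\<mu> k = \<mu>_prev k" if "K \<le> k" for k
  proof -
    have "0 \<le> (dqF k + dqH k (j k)) / ((1 - \<nu>) * dqN k)"
      using K[OF that] \<kappa> nu dqN_bounds(1)[of k] by (intro divide_nonneg_nonneg) auto
    then have "\<mu>_c k (j k) \<le> 0" by (simp add: \<mu>_c_def)
    then show ?thesis using \<mu>_prev_pos[of k] by (simp add: \<mu>_eq \<mu>_trial_def)
  qed
  have \<mu>_const: "\<mu> k = \<mu> K" if "K \<le> k" for k
    using that
  proof (induction rule: dec_induct)
    case (step n)
    then show ?case using \<mu>_same[of "Suc n"] by (simp add: \<mu>_prev_Suc)
  qed simp
  have "\<kappa> / 2 / \<mu> K \<le> dq k (j k) / \<mu> k" if "K \<le> k" for k
  proof -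
    have "0 \<le> \<mu> k * dqN k"
      using \<mu>_pos[of k] dqN_bounds(1)[of k] by simp
    moreover have "dq k (j k) = dqH k (j k) + \<mu> k * dqN k + dqF k"
      unfolding dq_eq \<mu>_eq[symmetric] ..
    ultimately have "\<kappa> / 2 \<le> dq k (j k)"
      using K[OF that] by linarith
    then show ?thesis
      unfolding \<mu>_const[OF that] using \<mu>_pos[of K] by (intro divide_right_mono) auto
  qed
  then have "\<forall>\<^sub>F k in sequentially. \<kappa> / 2 / \<mu> K \<le> dq k (j k) / \<mu> k"
    by (auto simp: eventually_sequentially)
  \<comment> \<open>With the penalty frozen at \<open>\<mu> K\<close>, the null sequence would have
    a positive lower bound.\<close>
  with dq_div_\<mu>_tendsto_0[OF f] have "\<kappa> / 2 / \<mu> K \<le> 0"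
    by (rule tendsto_lowerbound) simp
  moreover have "0 < \<kappa> / 2 / \<mu> K" using \<kappa> \<mu>_pos[of K] by simp
  ultimately show False by simp
qed

end

theorem theorem2:
  fixes f :: "real^'n \<Rightarrow> real"
    and g :: "real^'n \<Rightarrow> real^'n"
    and c :: "real^'n \<Rightarrow> real^'p"
    and J :: "real^'n \<Rightarrow> real^'n^'p"
    and \<eta>1 \<eta>2 \<gamma>1 \<gamma>2 \<nu> \<tau>1 \<tau>2 \<theta> \<xi> \<zeta> t :: real
    and eL eU :: nat
    and carry :: bool
    and x :: "nat \<Rightarrow> real^'n"
    and B :: "nat \<Rightarrow> real^'n^'n"
    and Z :: "nat \<Rightarrow> real^'m^'n"
    and v :: "nat \<Rightarrow> real^'n"
    and \<beta> :: "nat \<Rightarrow> real"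
    and \<mu>\<^sub>i\<^sub>n\<^sub>i\<^sub>t :: real
    and \<mu> :: "nat \<Rightarrow> real"
    and j :: "nat \<Rightarrow> nat"
    and b :: "nat \<Rightarrow> real"
    and I :: "'m set"
    and \<beta>max \<kappa>B \<kappa>n :: real
    and C :: "(real^'n) set"
  assumes algorithm:
      "ssarcqk_standing f g c J \<eta>1 \<eta>2 \<gamma>1 \<gamma>2 \<nu> \<tau>1 \<tau>2 \<theta> \<xi> \<zeta> t eL eU
         carry x B Z v \<beta> \<mu>\<^sub>i\<^sub>n\<^sub>i\<^sub>t \<mu> j b I \<beta>max"
    and A1: "bdd_below (range f)" "bounded (range g)" "bounded (range c)"
    and A2: "open C" "range x \<subseteq> C"
      "\<exists>L. L-lipschitz_on C g"
      "\<exists>L. L-lipschitz_on C c"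
      "\<And>i. \<exists>L. L-lipschitz_on C (\<lambda>y. row i (J y))"
    and A3: "0 \<le> \<kappa>B" "\<And>k. onorm ((*v) (B k)) \<le> \<kappa>B"
    and A4: "0 < \<kappa>n"
      "\<And>k. norm (normal_step (J (x k)) (c (x k))) \<le> \<kappa>n * norm (c (x k))"
  shows "liminf (\<lambda>k. ereal (norm (transpose (Z k) *v g (x k)))) = 0"
proof (rule liminf_eq_0I)
  interpret ssarcqk_standing f g c J \<eta>1 \<eta>2 \<gamma>1 \<gamma>2 \<nu> \<tau>1 \<tau>2 \<theta> \<xi> \<zeta> t eL eU
    carry x B Z v \<beta> \<mu>\<^sub>i\<^sub>n\<^sub>i\<^sub>t \<mu> j b I \<beta>max
    by (rule algorithm)
  show "\<not> (\<forall>\<^sub>F k in sequentially. \<epsilon> < norm (transpose (Z k) *v g (x k)))" if "0 < \<epsilon>" for \<epsilon>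
    using A1 A3 A4 that by (intro gradient_not_bounded_away)
qed simp

end
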